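(* There exists no pair consisting of a primitive right triangle and a primitive isosceles triangle which have the same perimeter and the same area.
   Context: An integral triangle is a (non-degenerate) triangle in the Euclidean plane all of whose sides have integral lengths. A primitive triangle is an integral triangle such that the greatest common divisor of the lengths of its three sides is $1$. *)

theory Defs
  imports "HOL-Analysis.Analysis"
begin

text \<open>A triangle is given by its three vertices in the Euclidean plane.\<close>

type_synonym triangle = "(real^2) \<times> (real^2) \<times> (real^2)"

fun nondegenerate :: "triangle \<Rightarrow> bool" where
  "nondegenerate (A, B, C) \<longleftrightarrow> \<not> collinear {A, B, C}"

fun side_lengths :: "triangle \<Rightarrow> real \<times> real \<times> real" where
  "side_lengths (A, B, C) = (dist B C, dist C A, dist A B)"

definition integral_triangle :: "triangle \<Rightarrow> bool" where
  "integral_triangle T \<longleftrightarrow> nondegenerate T \<and>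
     (case side_lengths T of (a, b, c) \<Rightarrow> a \<in> \<int> \<and> b \<in> \<int> \<and> c \<in> \<int>)"

text \<open>The floors only convert the side lengths, which are integral, to type \<^typ>\<open>int\<close>.\<close>

definition primitive_triangle :: "triangle \<Rightarrow> bool" where
  "primitive_triangle T \<longleftrightarrow> integral_triangle T \<and>
     (case side_lengths T of (a, b, c) \<Rightarrow> Gcd {\<lfloor>a\<rfloor>, \<lfloor>b\<rfloor>, \<lfloor>c\<rfloor>} = 1)"

fun right_triangle :: "triangle \<Rightarrow> bool" where
  "right_triangle (A, B, C) \<longleftrightarrow> nondegenerate (A, B, C) \<and>
     (orthogonal (B - A) (C - A) \<or> orthogonal (C - B) (A - B) \<or> orthogonal (A - C) (B - C))"

text \<open>At least two sides are equal; equilateral triangles count as isosceles.\<close>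

definition isosceles_triangle :: "triangle \<Rightarrow> bool" where
  "isosceles_triangle T \<longleftrightarrow> nondegenerate T \<and>
     (case side_lengths T of (a, b, c) \<Rightarrow> a = b \<or> b = c \<or> c = a)"

definition perimeter :: "triangle \<Rightarrow> real" where
  "perimeter T = (case side_lengths T of (a, b, c) \<Rightarrow> a + b + c)"

fun area :: "triangle \<Rightarrow> real" where
  "area (A, B, C) = measure lborel (convex hull {A, B, C})"

end

theory Submission
  imports Defs
begin

text \<open>Let \<open>p\<close> be the common semiperimeter. The right triangle with hypotenuse \<open>c\<close> has area
  \<open>p (p - c)\<close>, and the sides of the isosceles one are \<open>2 u, b, b\<close> with \<open>b + u = p\<close> and \<open>gcd b u = 1\<close>.
  Heron's formula gives \<open>p\<^sup>2 (p - c)\<^sup>2 = p u\<^sup>2 (b - u)\<close>. As \<open>p\<close> is coprime to \<open>u\<close>, it divides \<open>b - u\<close>,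
  which is impossible since \<open>0 < b - u < b + u = p\<close>.\<close>

lemma no_pythagorean_isosceles_pair:
  fixes x y c a b :: int
  assumes pyth: "x\<^sup>2 + y\<^sup>2 = c\<^sup>2" and perim: "x + y + c = a + 2 * b"
    and area: "4 * x\<^sup>2 * y\<^sup>2 = a\<^sup>2 * (4 * b\<^sup>2 - a\<^sup>2)"
    and "coprime a b" "0 < a" "a < 2 * b"
  shows False
proof -
  \<comment> \<open>A square has the parity of its base, so the Pythagorean equation makes the
    perimeter \<open>a + 2 * b\<close> even.\<close>
  have "even (x\<^sup>2 + y\<^sup>2 - c\<^sup>2)"
    using pyth by simp
  hence "even (x + y + c)"
    by simp
  hence "even a"
    unfolding perim by simp
  then obtain u where u: "a = 2 * u"
    by blast
  define p where "p = b + u"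
  have c: "c = 2 * p - x - y"
    using perim u by (simp add: p_def)
  \<comment> \<open>Here \<open>2 * p\<close> is \<open>x + y + c\<close> and
    \<open>2 * (p - c)\<close> is \<open>x + y - c\<close>; their product is
    \<open>(x + y)\<^sup>2 - c\<^sup>2\<close>, that is, \<open>2 * x * y\<close>.\<close>
  have "x * y = 2 * p * (p - c)"
    using pyth unfolding c by (simp add: algebra_simps power2_eq_square)
  hence "(2 * p * (p - c))\<^sup>2 = x\<^sup>2 * y\<^sup>2"
    by (metis power_mult_distrib)
  also have "\<dots> = 4 * (p * (u\<^sup>2 * (b - u)))"
    using area by (simp add: u p_def algebra_simps power2_eq_square)
  finally have "p * (p * (p - c)\<^sup>2) = p * (u\<^sup>2 * (b - u))"
    by algebra
  moreover have "p > 0"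
    using assms u p_def by simp
  \<comment> \<open>Only one of the two factors \<open>p\<close> on the left cancels; the other
    gives the divisibility.\<close>
  ultimately have "p dvd u\<^sup>2 * (b - u)"
    by (metis dvd_triv_left less_irrefl mult_left_cancel)
  moreover have "coprime p (u\<^sup>2)"
  proof -
    have "coprime b u"
      using \<open>coprime a b\<close> by (simp add: u coprime_commute)
    hence "gcd p u = 1"
      by (simp add: p_def coprime_iff_gcd_eq_1)
    thus ?thesis
      by (simp flip: coprime_iff_gcd_eq_1)
  qed
  ultimately have "p dvd b - u"
    by (simp add: coprime_dvd_mult_right_iff)
  hence "p \<le> b - u"
    using assms u by (intro zdvd_imp_le) auto
  thus False
    using assms u p_def by simp
qed

text \<open>Equality in the triangle inequality would put \<open>C\<close> on the segment from
  \<open>A\<close> to \<open>B\<close>.\<close>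

lemma dist_less_if_not_collinear:
  fixes A B C :: "'a :: euclidean_space"
  assumes "\<not> collinear {A, B, C}"
  shows "dist A B < dist A C + dist C B"
proof -
  have "\<not> between (A, B) C"
    using assms collinear_between_cases by blast
  hence "dist A B \<noteq> dist A C + dist C B"
    by (simp add: between)
  thus ?thesis
    using dist_triangle[of A B C] by linarith
qed

text \<open>Squaring removes the root from Heron's formula and the factor 4 clears the denominators.
  What remains is an integer polynomial in the sides, so for integral sides the area can be compared
  within the integers.\<close>

lemma heron_squared:
  assumes "side_lengths T = (a, b, c)"
  shows "(4 * area T)\<^sup>2 = 4 * a\<^sup>2 * b\<^sup>2 - (a\<^sup>2 + b\<^sup>2 - c\<^sup>2)\<^sup>2"
proof -
  obtain A B C where T: "T = (A, B, C)"
    by (cases T)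
  have sides: "a = dist B C" "b = dist A C" "c = dist A B"
    using assms by (auto simp: T dist_commute)
  define s where "s = (a + b + c) / 2"
  \<comment> \<open>Squaring the root returns the radicand only if that is nonnegative; each factor
    is, by a triangle inequality.\<close>
  have "0 \<le> s * (s - a) * (s - b) * (s - c)"
    using dist_triangle[of A B C] dist_triangle[of A C B] dist_triangle[of B C A]
    by (intro mult_nonneg_nonneg) (auto simp: s_def sides dist_commute)
  hence "(4 * area T)\<^sup>2 = 16 * (s * (s - a) * (s - b) * (s - c))"
    unfolding T area.simps heron[of A B C, folded sides, folded s_def] by (simp add: power_mult_distrib)
  also have "\<dots> = 4 * a\<^sup>2 * b\<^sup>2 - (a\<^sup>2 + b\<^sup>2 - c\<^sup>2)\<^sup>2"
    unfolding s_def by (simp add: field_simps power2_eq_square)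
  finally show ?thesis .
qed

lemma dist_pythagoras:
  assumes "orthogonal (A - C) (B - C)"
  shows "(dist B C)\<^sup>2 + (dist C A)\<^sup>2 = (dist A B)\<^sup>2"
proof -
  have "(norm ((A - C) - (B - C)))\<^sup>2 = (norm (A - C))\<^sup>2 + (norm (B - C))\<^sup>2"
    using assms by (simp add: orthogonal_def power2_norm_eq_inner inner_diff inner_commute)
  thus ?thesis
    by (simp add: dist_norm norm_minus_commute)
qed

lemma right_triangle_sides:
  assumes "integral_triangle T" "right_triangle T"
  obtains x y z :: int where "x\<^sup>2 + y\<^sup>2 = z\<^sup>2"
    "perimeter T = of_int (x + y + z)" "(4 * area T)\<^sup>2 = of_int (4 * x\<^sup>2 * y\<^sup>2)"
proof -
  obtain A B C where T: "T = (A, B, C)"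
    by (cases T)
  obtain a b c :: int where "dist B C = of_int a" "dist C A = of_int b" "dist A B = of_int c"
    using assms(1) unfolding T integral_triangle_def by (auto elim!: Ints_cases)
  hence sides: "side_lengths T = (of_int a, of_int b, of_int c)"
    by (simp add: T)
  have area: "(4 * area T)\<^sup>2 = of_int (4 * a\<^sup>2 * b\<^sup>2 - (a\<^sup>2 + b\<^sup>2 - c\<^sup>2)\<^sup>2)"
    using heron_squared[OF sides] by simp
  \<comment> \<open>The disjuncts belong to a right angle at \<open>A\<close>, \<open>B\<close> and
    \<open>C\<close>, in this order.\<close>
  have "of_int (b\<^sup>2 + c\<^sup>2) = (of_int (a\<^sup>2) :: real) \<or> of_int (c\<^sup>2 + a\<^sup>2) = (of_int (b\<^sup>2) :: real)
      \<or> of_int (a\<^sup>2 + b\<^sup>2) = (of_int (c\<^sup>2) :: real)"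
    using assms(2) sides dist_pythagoras[of B A C] dist_pythagoras[of C B A] dist_pythagoras[of A C B]
    by (auto simp: T)
  hence "b\<^sup>2 + c\<^sup>2 = a\<^sup>2 \<or> c\<^sup>2 + a\<^sup>2 = b\<^sup>2 \<or> a\<^sup>2 + b\<^sup>2 = c\<^sup>2"
    unfolding of_int_eq_iff .
  thus thesis
  proof (elim disjE)
    assume eq: "b\<^sup>2 + c\<^sup>2 = a\<^sup>2"
    \<comment> \<open>The Heron polynomial singles out \<open>c\<close>, and its last square
      vanishes only for hypotenuse \<open>c\<close>. For hypotenuse \<open>a\<close> that square is
      \<open>(2 * b\<^sup>2)\<^sup>2\<close>, which leaves
      \<open>4 * b\<^sup>2 * (a\<^sup>2 - b\<^sup>2)\<close>.\<close>
    have "4 * a\<^sup>2 * b\<^sup>2 - (a\<^sup>2 + b\<^sup>2 - c\<^sup>2)\<^sup>2 = 4 * b\<^sup>2 * c\<^sup>2"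
      unfolding eq[symmetric] by (simp add: algebra_simps power2_eq_square)
    with eq area show thesis
      by (intro that[of b c a]) (simp_all add: perimeter_def sides)
  next
    assume eq: "c\<^sup>2 + a\<^sup>2 = b\<^sup>2"
    have "4 * a\<^sup>2 * b\<^sup>2 - (a\<^sup>2 + b\<^sup>2 - c\<^sup>2)\<^sup>2 = 4 * c\<^sup>2 * a\<^sup>2"
      unfolding eq[symmetric] by (simp add: algebra_simps power2_eq_square)
    with eq area show thesis
      by (intro that[of c a b]) (simp_all add: perimeter_def sides)
  next
    assume "a\<^sup>2 + b\<^sup>2 = c\<^sup>2"
    with area show thesis
      by (intro that[of a b c]) (simp_all add: perimeter_def sides)
  qed
qed

text \<open>With base \<open>a\<close> and both legs \<open>b\<close>, the gcd of the three sides is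
  that of \<open>a\<close> and \<open>b\<close>, the strict triangle inequality for the base reads
  \<open>a < 2 * b\<close>, and Heron's polynomial factors.\<close>

lemma isosceles_triangle_sides:
  assumes "primitive_triangle S" "isosceles_triangle S"
  obtains a b :: int where "coprime a b" "0 < a" "a < 2 * b"
    "perimeter S = of_int (a + 2 * b)" "(4 * area S)\<^sup>2 = of_int (a\<^sup>2 * (4 * b\<^sup>2 - a\<^sup>2))"
proof -
  obtain A B C where S: "S = (A, B, C)"
    by (cases S)
  have "\<not> collinear {A, B, C}"
    and "dist B C \<in> \<int>" "dist C A \<in> \<int>" "dist A B \<in> \<int>"
    using assms(1) by (auto simp: S primitive_triangle_def integral_triangle_def)
  then obtain a b c :: int
    where dists: "dist B C = of_int a" "dist C A = of_int b" "dist A B = of_int c"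
    by (auto elim!: Ints_cases)
  hence sides: "side_lengths S = (of_int a, of_int b, of_int c)"
    by (simp add: S)
  have pos: "0 < a" "0 < b" "0 < c"
  proof -
    have "A \<noteq> B" "B \<noteq> C" "C \<noteq> A"
      using \<open>\<not> collinear {A, B, C}\<close> by (auto simp: insert_commute)
    hence "0 < dist B C" "0 < dist C A" "0 < dist A B"
      by simp_all
    thus "0 < a" "0 < b" "0 < c"
      unfolding dists by simp_all
  qed
  have "of_int a < (of_int (b + c) :: real)" "of_int b < (of_int (c + a) :: real)"
      "of_int c < (of_int (a + b) :: real)"
    using \<open>\<not> collinear {A, B, C}\<close> dist_less_if_not_collinear[of A B C]
      dist_less_if_not_collinear[of B C A] dist_less_if_not_collinear[of C A B] dists
    by (simp_all add: insert_commute dist_commute)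
  hence triangle: "a < b + c" "b < c + a" "c < a + b"
    by (simp_all only: of_int_less_iff)
  have gcd: "Gcd {a, b, c} = 1"
    using assms(1) by (simp add: primitive_triangle_def sides)
  have area: "(4 * area S)\<^sup>2 = of_int (4 * a\<^sup>2 * b\<^sup>2 - (a\<^sup>2 + b\<^sup>2 - c\<^sup>2)\<^sup>2)"
    using heron_squared[OF sides] by simp
  have "a = b \<or> b = c \<or> c = a"
    using assms(2) by (simp add: isosceles_triangle_def sides)
  thus thesis
  proof (elim disjE)
    \<comment> \<open>In each case the base is the side that the equation does not mention, here
      \<open>c\<close>.\<close>
    assume "a = b"
    moreover from this have "4 * a\<^sup>2 * b\<^sup>2 - (a\<^sup>2 + b\<^sup>2 - c\<^sup>2)\<^sup>2 = c\<^sup>2 * (4 * b\<^sup>2 - c\<^sup>2)"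
      by (simp add: algebra_simps power2_eq_square)
    ultimately show thesis
      using gcd area pos triangle
      by (intro that[of c b]) (simp_all add: perimeter_def sides coprime_iff_gcd_eq_1 gcd.commute)
  next
    assume "b = c"
    moreover from this have "4 * a\<^sup>2 * b\<^sup>2 - (a\<^sup>2 + b\<^sup>2 - c\<^sup>2)\<^sup>2 = a\<^sup>2 * (4 * b\<^sup>2 - a\<^sup>2)"
      by (simp add: algebra_simps power2_eq_square)
    ultimately show thesis
      using gcd area pos triangle
      by (intro that[of a b]) (simp_all add: perimeter_def sides coprime_iff_gcd_eq_1)
  next
    assume "c = a"
    moreover from this have "4 * a\<^sup>2 * b\<^sup>2 - (a\<^sup>2 + b\<^sup>2 - c\<^sup>2)\<^sup>2 = b\<^sup>2 * (4 * a\<^sup>2 - b\<^sup>2)"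
      by (simp add: algebra_simps power2_eq_square)
    ultimately show thesis
      using gcd area pos triangle
      by (intro that[of b a]) (simp_all add: perimeter_def sides coprime_iff_gcd_eq_1 gcd.commute)
  qed
qed

theorem theorem1p3:
  shows "\<not> (\<exists>T S :: triangle.
           primitive_triangle T \<and> right_triangle T \<and>
           primitive_triangle S \<and> isosceles_triangle S \<and>
           perimeter T = perimeter S \<and> area T = area S)"
proof clarify
  fix T S :: triangle
  assume T: "primitive_triangle T" "right_triangle T"
    and S: "primitive_triangle S" "isosceles_triangle S"
    and eq: "perimeter T = perimeter S" "area T = area S"
  have "integral_triangle T"
    using T(1) by (simp add: primitive_triangle_def)
  from this T(2) obtain x y z :: int where right: "x\<^sup>2 + y\<^sup>2 = z\<^sup>2"
    "perimeter T = of_int (x + y + z)" "(4 * area T)\<^sup>2 = of_int (4 * x\<^sup>2 * y\<^sup>2)"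
    by (rule right_triangle_sides)
  from S obtain a b :: int where isosceles: "coprime a b" "0 < a" "a < 2 * b"
    "perimeter S = of_int (a + 2 * b)" "(4 * area S)\<^sup>2 = of_int (a\<^sup>2 * (4 * b\<^sup>2 - a\<^sup>2))"
    by (rule isosceles_triangle_sides)
  \<comment> \<open>Injectivity of \<open>of_int\<close> turns the equal real perimeters and squared
    areas into integer equations.\<close>
  have "x + y + z = a + 2 * b" "4 * x\<^sup>2 * y\<^sup>2 = a\<^sup>2 * (4 * b\<^sup>2 - a\<^sup>2)"
    using eq right isosceles by (metis of_int_eq_iff)+
  with right(1) isosceles(1-3) show False
    using no_pythagorean_isosceles_pair by blast
qed

end
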